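(* Let $d\ge1$, let $p_1,\dots,p_d$ be distinct primes, and fix $\sigma>\frac12$. For $r_1,\dots,r_d\ge0$ with $R:=\sum_{j=1}^dr_j<\sigma-\frac12$, let $\varphi(s)=\sigma+\sum_{j=1}^dr_jp_j^{-s}$. Then, as $R\to0$ (with $\sigma$ fixed), \[ \left\|C_{\sigma+\sum_{j=1}^dr_jp_j^{-s}}\right\|^2=\zeta(2\sigma)+\frac{\zeta'(2\sigma)^2}{\zeta(2\sigma)}\sum_{j=1}^dr_j^2+O(R^4). \]
   Context: $\mathcal H^2$ is the Hilbert space of Dirichlet series $f(s)=\sum_{n\ge1}a_nn^{-s}$ with $\|f\|^2=\sum_n|a_n|^2<\infty$; its elements are analytic on $\{\operatorname{Re}s>1/2\}$. The symbol $\varphi$ maps $\{\operatorname{Re}s>0\}$ into $\{\operatorname{Re}s>1/2\}$, and $C_\varphi f=f\circ\varphi$ is the induced composition operator on $\mathcal H^2$ (bounded, by the Gordon–Hedenmalm theorem). $\zeta$ is the Riemann zeta function. The $O(R^4)$ means: there are constants $K,R_0>0$ (for the fixed $\sigma$) such that the remainder is at most $KR^4$ in absolute value for all $(r_1,\dots,r_d)\in[0,\infty)^d$ with $R\le R_0$. *)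

theory Defs
  imports "HOL-Analysis.Analysis" "HOL-Computational_Algebra.Primes"
begin

section \<open>The Hilbert space of Dirichlet series with square-summable coefficients\<close>

text \<open>
  An element is stored as its coefficient sequence \<open>a 1, a 2, \<dots>\<close>; the unused entry at index 0
  is fixed to be 0. Only the underlying real structure is recorded in the type classes: the
  inner product is the real part of the complex one, and it induces the same norm.
  The operator norm of a complex-linear operator is not affected by this restriction of scalars.
\<close>

typedef h2 = "{a :: nat \<Rightarrow> complex. a 0 = 0 \<and> summable (\<lambda>n. (cmod (a n))\<^sup>2)}"
  morphisms h2_coeff Abs_h2
  by (rule exI[of _ "\<lambda>_. 0"]) simp

setup_lifting type_definition_h2

lemma h2_coeff_0 [simp]: "h2_coeff f 0 = 0"
  and summable_h2_coeff: "summable (\<lambda>n. (cmod (h2_coeff f n))\<^sup>2)"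
  using h2_coeff[of f] by auto

lemma summable_norm_mult:
  fixes a b :: "nat \<Rightarrow> complex"
  assumes "summable (\<lambda>n. (cmod (a n))\<^sup>2)" "summable (\<lambda>n. (cmod (b n))\<^sup>2)"
  shows "summable (\<lambda>n. cmod (a n) * cmod (b n))"
proof (rule summable_comparison_test')
  show "summable (\<lambda>n. (cmod (a n))\<^sup>2 + (cmod (b n))\<^sup>2)"
    using assms by (rule summable_add)
  fix n :: nat assume "0 \<le> n"
  have "2 * (cmod (a n) * cmod (b n)) \<le> (cmod (a n))\<^sup>2 + (cmod (b n))\<^sup>2"
    using sum_squares_bound[of "cmod (a n)" "cmod (b n)"] by simp
  moreover have "0 \<le> cmod (a n) * cmod (b n)"
    by simp
  ultimately show "norm (cmod (a n) * cmod (b n)) \<le> (cmod (a n))\<^sup>2 + (cmod (b n))\<^sup>2"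
    unfolding real_norm_def by linarith
qed

lemma summable_inner_coeff:
  fixes a b :: "nat \<Rightarrow> complex"
  assumes "summable (\<lambda>n. (cmod (a n))\<^sup>2)" "summable (\<lambda>n. (cmod (b n))\<^sup>2)"
  shows "summable (\<lambda>n. a n \<bullet> b n)"
  by (rule summable_comparison_test'[OF summable_norm_mult[OF assms], of 0])
     (simp add: Cauchy_Schwarz_ineq2)

instantiation h2 :: real_inner
begin

lift_definition zero_h2 :: h2 is "\<lambda>_. 0" by simp

lift_definition plus_h2 :: "h2 \<Rightarrow> h2 \<Rightarrow> h2" is "\<lambda>a b n. a n + b n"
proof -
  fix a b :: "nat \<Rightarrow> complex"
  assume a: "a 0 = 0 \<and> summable (\<lambda>n. (cmod (a n))\<^sup>2)"
    and b: "b 0 = 0 \<and> summable (\<lambda>n. (cmod (b n))\<^sup>2)"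
  have "summable (\<lambda>n. (cmod (a n))\<^sup>2 + 2 * (a n \<bullet> b n) + (cmod (b n))\<^sup>2)"
    using a b by (intro summable_add summable_mult summable_inner_coeff) auto
  moreover have "(\<lambda>n. (cmod (a n + b n))\<^sup>2)
      = (\<lambda>n. (cmod (a n))\<^sup>2 + 2 * (a n \<bullet> b n) + (cmod (b n))\<^sup>2)"
    by (rule ext) (simp add: power2_norm_eq_inner inner_add inner_commute)
  ultimately show "a 0 + b 0 = 0 \<and> summable (\<lambda>n. (cmod (a n + b n))\<^sup>2)"
    using a b by simp
qed

lift_definition scaleR_h2 :: "real \<Rightarrow> h2 \<Rightarrow> h2" is "\<lambda>c a n. c *\<^sub>R a n"
  by (auto simp: power_mult_distrib intro!: summable_mult)

lift_definition uminus_h2 :: "h2 \<Rightarrow> h2" is "\<lambda>a n. - a n" by simp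

definition minus_h2 :: "h2 \<Rightarrow> h2 \<Rightarrow> h2" where "f - g = f + - (g :: h2)"

lift_definition inner_h2 :: "h2 \<Rightarrow> h2 \<Rightarrow> real" is "\<lambda>a b. \<Sum>n. a n \<bullet> b n" .

lift_definition norm_h2 :: "h2 \<Rightarrow> real" is "\<lambda>a. sqrt (\<Sum>n. (cmod (a n))\<^sup>2)" .

definition sgn_h2 :: "h2 \<Rightarrow> h2" where "sgn f = inverse (norm f) *\<^sub>R (f :: h2)"

definition dist_h2 :: "h2 \<Rightarrow> h2 \<Rightarrow> real" where "dist f g = norm (f - g :: h2)"

definition uniformity_h2 :: "(h2 \<times> h2) filter" where
  "uniformity_h2 = (INF e\<in>{0<..}. principal {(f :: h2, g). dist f g < e})"

definition open_h2 :: "h2 set \<Rightarrow> bool" where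
  "open_h2 (U :: h2 set) \<longleftrightarrow> (\<forall>f\<in>U. eventually (\<lambda>(f', g). f' = f \<longrightarrow> g \<in> U) uniformity)"

instance
proof
  fix f g h :: h2 and c d :: real
  show "f + g + h = f + (g + h)" by transfer (simp add: add.assoc)
  show "f + g = g + f" by transfer (simp add: add.commute)
  show "0 + f = f" by transfer simp
  show "- f + f = 0" by transfer simp
  show "f - g = f + - g" by (rule minus_h2_def)
  show "c *\<^sub>R (f + g) = c *\<^sub>R f + c *\<^sub>R g" by transfer (simp add: scaleR_add_right)
  show "(c + d) *\<^sub>R f = c *\<^sub>R f + d *\<^sub>R f" by transfer (simp add: scaleR_add_left)
  show "c *\<^sub>R d *\<^sub>R f = (c * d) *\<^sub>R f" by transfer simp
  show "1 *\<^sub>R f = f" by transfer simp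
  show "sgn f = inverse (norm f) *\<^sub>R f" by (rule sgn_h2_def)
  show "dist f g = norm (f - g)" by (rule dist_h2_def)
  show "f \<bullet> g = g \<bullet> f" by transfer (simp add: inner_commute)
  show "(f + g) \<bullet> h = f \<bullet> h + g \<bullet> h"
    by transfer (simp add: inner_add_left suminf_add summable_inner_coeff)
  show "(c *\<^sub>R f) \<bullet> g = c * (f \<bullet> g)"
    by transfer (simp add: suminf_mult summable_inner_coeff)
  show "0 \<le> f \<bullet> f"
    by transfer (auto simp flip: power2_norm_eq_inner intro!: suminf_nonneg)
  show "(f \<bullet> f = 0) = (f = 0)"
    by transfer (auto simp flip: power2_norm_eq_inner simp: suminf_eq_zero_iff fun_eq_iff)
  show "norm f = sqrt (f \<bullet> f)"
    by transfer (simp add: power2_norm_eq_inner)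
qed (simp_all add: uniformity_h2_def open_h2_def)

end

definition h2_eval :: "h2 \<Rightarrow> complex \<Rightarrow> complex" where
  "h2_eval f s = (\<Sum>n. h2_coeff f n * of_nat n powr (- s))"

lemma h2_eval_summable:
  assumes "Re s > 1/2"
  shows "summable (\<lambda>n. cmod (h2_coeff f n * of_nat n powr (- s)))"
proof -
  have "summable (\<lambda>n. real n powr (- (2 * Re s)))"
    using assms by (simp add: summable_real_powr_iff)
  also have "(\<lambda>n. real n powr (- (2 * Re s))) = (\<lambda>n. (cmod (of_nat n powr (- s)))\<^sup>2)"
  proof
    fix n :: nat
    show "real n powr (- (2 * Re s)) = (cmod (of_nat n powr (- s)))\<^sup>2"
      by (cases "n = 0") (simp_all add: norm_powr_real_powr power2_eq_square flip: powr_add)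
  qed
  finally show ?thesis
    using summable_norm_mult[OF summable_h2_coeff] by (simp add: norm_mult)
qed

section \<open>Composition operators\<close>

text \<open>
  The composite of an element of the space with the symbol is identified with a Dirichlet series
  of the space if the two agree on the half-plane where all elements of the space converge; by
  the uniqueness lemma below there is at most one such series.
\<close>

definition comp_op :: "(complex \<Rightarrow> complex) \<Rightarrow> h2 \<Rightarrow> h2" where
  "comp_op \<phi> f = (THE g. \<forall>s. Re s > 1/2 \<longrightarrow> h2_eval g s = h2_eval f (\<phi> s))"

definition bounded_comp_op :: "(complex \<Rightarrow> complex) \<Rightarrow> bool" where
  "bounded_comp_op \<phi> \<longleftrightarrow>
     (\<forall>f. \<exists>g. \<forall>s. Re s > 1/2 \<longrightarrow> h2_eval g s = h2_eval f (\<phi> s)) \<and>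
     bounded_linear (comp_op \<phi>)"

lemma h2_eval_inject:
  assumes eq: "\<And>s. Re s > 1/2 \<Longrightarrow> h2_eval f s = h2_eval g s"
  shows "f = g"
proof (rule ccontr)
  assume "f \<noteq> g"
  define c where "c n = h2_coeff f n - h2_coeff g n" for n
  have "\<exists>n. c n \<noteq> 0"
    using \<open>f \<noteq> g\<close> by (auto simp: c_def h2_coeff_inject[symmetric] fun_eq_iff)
  then obtain N where N: "c N \<noteq> 0" and below: "\<And>n. n < N \<Longrightarrow> c n = 0"
    using exists_least_iff[of "\<lambda>n. c n \<noteq> 0"] by blast
  have "N > 0"
    using N by (cases N) (auto simp: c_def)
  define A where "A = (\<lambda>n. cmod (c n) * real n powr (- 2))"
  have A: "summable A"
  proof (rule summable_comparison_test'[of _ 0])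
    show "summable (\<lambda>n. cmod (h2_coeff f n * of_nat n powr (- 2))
        + cmod (h2_coeff g n * of_nat n powr (- 2)))"
      using h2_eval_summable[of 2 f] h2_eval_summable[of 2 g] by (intro summable_add) auto
    fix n :: nat
    have "cmod (of_nat n powr (- 2)) = real n powr (- 2)"
      by (cases "n = 0") (simp_all add: norm_powr_real_powr)
    moreover have "cmod (c n) \<le> cmod (h2_coeff f n) + cmod (h2_coeff g n)"
      unfolding c_def by (rule norm_triangle_ineq4)
    ultimately show "norm (A n) \<le> cmod (h2_coeff f n * of_nat n powr (- 2))
        + cmod (h2_coeff g n * of_nat n powr (- 2))"
      by (simp add: A_def norm_mult mult_right_mono flip: distrib_right)
  qed
  have A_nonneg: "A n \<ge> 0" for n
    by (simp add: A_def)
  \<comment> \<open>the leading coefficient is dominated by the tail at every large real abscissa\<close>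
  have bound: "cmod (c N) * real N powr (- x) \<le> real (Suc N) powr (2 - x) * suminf A"
    if x: "x > 2" for x :: real
  proof -
    define t where "t n = c n * of_nat n powr (- complex_of_real x)" for n
    have sm: "summable (\<lambda>n. h2_coeff h n * of_nat n powr (- complex_of_real x))" for h
      by (rule summable_norm_cancel, rule h2_eval_summable) (use x in simp)
    have t_eq: "t = (\<lambda>n. h2_coeff f n * of_nat n powr (- complex_of_real x)
        - h2_coeff g n * of_nat n powr (- complex_of_real x))"
      by (simp add: t_def c_def fun_eq_iff left_diff_distrib)
    have t: "summable t"
      unfolding t_eq by (intro summable_diff sm)
    have "suminf t = h2_eval f (of_real x) - h2_eval g (of_real x)"
      unfolding t_eq h2_eval_def by (intro suminf_diff[symmetric] sm)
    also have "\<dots> = 0"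
      using eq[of "of_real x"] x by simp
    finally have "0 = (\<Sum>n. t (n + Suc N)) + sum t {..<Suc N}"
      using suminf_split_initial_segment[OF t, of "Suc N"] by simp
    also have "sum t {..<Suc N} = t N"
      using below by (simp add: t_def)
    finally have tN: "cmod (t N) = cmod (\<Sum>n. t (n + Suc N))"
      by (metis add_eq_0_iff norm_minus_cancel)
    have norm_t: "cmod (t n) = cmod (c n) * real n powr (- x)" for n
      by (cases "n = 0") (simp_all add: t_def norm_mult norm_powr_real_powr)
    have tail: "cmod (t (n + Suc N)) \<le> real (Suc N) powr (2 - x) * A (n + Suc N)" for n
    proof -
      have "real (n + Suc N) powr (- x)
          = real (n + Suc N) powr (2 - x) * real (n + Suc N) powr (- 2)"
        by (simp flip: powr_add)
      also have "\<dots> \<le> real (Suc N) powr (2 - x) * real (n + Suc N) powr (- 2)"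
        using x by (intro mult_right_mono powr_mono2') auto
      finally show ?thesis
        unfolding norm_t A_def
        by (metis mult.left_commute mult_left_mono norm_ge_zero)
    qed
    have A': "summable (\<lambda>n. A (n + Suc N))"
      using A by (rule summable_ignore_initial_segment)
    have sum_t: "summable (\<lambda>n. cmod (t (n + Suc N)))"
      by (rule summable_comparison_test'[OF summable_mult[OF A'], of 0]) (use tail in simp)
    have "cmod (t N) \<le> (\<Sum>n. real (Suc N) powr (2 - x) * A (n + Suc N))"
      unfolding tN
      by (rule order_trans[OF summable_norm[OF sum_t] suminf_le[OF tail sum_t summable_mult[OF A']]])
    also have "\<dots> = real (Suc N) powr (2 - x) * (\<Sum>n. A (n + Suc N))"
      by (rule suminf_mult[OF A'])
    also have "(\<Sum>n. A (n + Suc N)) \<le> suminf A"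
      using suminf_split_initial_segment[OF A, of "Suc N"] A_nonneg
      by (simp add: sum_nonneg del: sum.lessThan_Suc)
    finally show ?thesis
      by (simp add: norm_t mult_left_mono)
  qed
  define q where "q = real N / real (Suc N)"
  have q: "0 < q" "q < 1"
    using \<open>N > 0\<close> by (auto simp: q_def)
  define C where "C = real (Suc N) powr 2 * suminf A"
  have "cmod (c N) \<le> C * q powr x" if "x > 2" for x :: real
  proof -
    have "cmod (c N) = cmod (c N) * real N powr (- x) * real N powr x"
      using \<open>N > 0\<close> by (simp add: powr_minus)
    also have "\<dots> \<le> real (Suc N) powr (2 - x) * suminf A * real N powr x"
      using bound[OF that] by (intro mult_right_mono) auto
    also have "\<dots> = C * q powr x"
      using \<open>N > 0\<close> unfolding C_def q_def by (simp add: powr_diff powr_divide)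
    finally show ?thesis .
  qed
  from this[of "real (n + 3)" for n] have "cmod (c N) \<le> C * q ^ (n + 3)" for n
    using powr_realpow[OF q(1), of "n + 3"] by (simp del: power_Suc) metis
  moreover have "(\<lambda>n. C * q ^ (n + 3)) \<longlonglongrightarrow> C * 0"
    by (intro tendsto_mult_left LIMSEQ_ignore_initial_segment LIMSEQ_realpow_zero) (use q in auto)
  ultimately have "cmod (c N) \<le> C * 0"
    by (intro LIMSEQ_le_const) auto
  then show False
    using N by simp
qed

section \<open>The zeta function\<close>

text \<open>The Dirichlet series represents the Riemann zeta function, and is only used, for \<open>Re s > 1\<close>.\<close>

definition zeta :: "complex \<Rightarrow> complex" where
  "zeta s = (\<Sum>n. of_nat (Suc n) powr (- s))"

end

(*
  Expanding n^(-sigma - X) = n^(-sigma) * sum_k (-log n)^k X^k / k! with X = sum_j r_j p_j^(-s)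
  shows that the m-th coefficient of the composite with f = sum a_n n^(-s) is c_k(m) / k! * L_k(f).
  Here k is the number of prime factors of m counted with multiplicity, c_k(m) is the coefficient
  of m^(-s) in X^k, and L_k(f) = sum_n a_n n^(-sigma) (-log n)^k.  The coefficients c_k for
  different k have disjoint supports, so

    |C f|^2 = sum_k B_k |L_k(f)|^2,   B_0 = 1,  B_1 = S = sum_j r_j^2,  B_k <= (R^k / k!)^2.

  As |L_k(f)| <= C k! delta^(-k) |f| for delta < sigma - 1/2, the terms with k >= 2 contribute
  O(R^4).  The terms k = 0, 1 form a rank-two perturbation problem with Gram matrix entries
  Z = zeta(2 sigma), P = -zeta'(2 sigma), Q = zeta''(2 sigma): completing the square bounds them
  by Z + S P^2 / Z + O(S^2), and the test function f = sum_n n^(-sigma) n^(-s) gives the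
  lower bound Z + S P^2 / Z.
*)
theory Submission
  imports Defs
begin

section \<open>Moments against powers of the logarithm\<close>

text \<open>The finite inequality for \<open>L2_set\<close> bounds every partial sum, hence the
  series.\<close>

lemma cauchy_schwarz_suminf:
  fixes a b :: "nat \<Rightarrow> complex"
  assumes a: "summable (\<lambda>n. (cmod (a n))\<^sup>2)" and b: "summable (\<lambda>n. (cmod (b n))\<^sup>2)"
  shows "(\<Sum>n. cmod (a n) * cmod (b n)) \<le> sqrt (\<Sum>n. (cmod (a n))\<^sup>2) * sqrt (\<Sum>n. (cmod (b n))\<^sup>2)"
proof (rule suminf_le_const[OF summable_norm_mult[OF a b]])
  fix N
  have L2: "L2_set (\<lambda>n. cmod (f n)) {..<N} \<le> sqrt (\<Sum>n. (cmod (f n))\<^sup>2)"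
    if "summable (\<lambda>n. (cmod (f n))\<^sup>2)" for f :: "nat \<Rightarrow> complex"
    unfolding L2_set_def by (intro real_sqrt_le_mono sum_le_suminf that) auto
  have "(\<Sum>n<N. cmod (a n) * cmod (b n))
      \<le> L2_set (\<lambda>n. cmod (a n)) {..<N} * L2_set (\<lambda>n. cmod (b n)) {..<N}"
    using L2_set_mult_ineq[of "\<lambda>n. cmod (a n)" "\<lambda>n. cmod (b n)" "{..<N}"] by simp
  also have "\<dots> \<le> sqrt (\<Sum>n. (cmod (a n))\<^sup>2) * sqrt (\<Sum>n. (cmod (b n))\<^sup>2)"
    by (intro mult_mono L2 a b L2_set_nonneg real_sqrt_ge_zero suminf_nonneg) auto
  finally show "(\<Sum>n<N. cmod (a n) * cmod (b n))
      \<le> sqrt (\<Sum>n. (cmod (a n))\<^sup>2) * sqrt (\<Sum>n. (cmod (b n))\<^sup>2)" .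
qed

lemma norm_h2: "norm f = sqrt (\<Sum>n. (cmod (h2_coeff f n))\<^sup>2)"
  by (simp add: norm_h2.rep_eq)

text \<open>Fubini for iterated series: the summable row bounds \<open>b\<close> make the double
  family absolutely summable, so the interchange is done for unordered sums and read back as
  series.\<close>

lemma suminf_swap_bounded:
  fixes F :: "nat \<Rightarrow> nat \<Rightarrow> complex"
  assumes inner: "\<And>k. summable (\<lambda>n. norm (F k n))"
    and le: "\<And>k. (\<Sum>n. norm (F k n)) \<le> b k" and b: "summable b"
  shows "(\<Sum>k. \<Sum>n. F k n) = (\<Sum>n. \<Sum>k. F k n)"
proof -
  have eq: "infsum f UNIV = suminf f" if "f summable_on UNIV" for f :: "nat \<Rightarrow> 'a :: {comm_monoid_add, t2_space}"
    using has_sum_imp_sums[OF has_sum_infsum[OF that]] by (simp add: sums_iff)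
  have inner': "(\<lambda>n. norm (F k n)) summable_on UNIV" for k
    using inner by (intro norm_summable_imp_summable_on) simp
  have outer: "summable (\<lambda>k. \<Sum>n. norm (F k n))"
    by (rule summable_comparison_test'[OF b, of 0]) (use le in \<open>simp add: suminf_nonneg inner\<close>)
  have fam: "(\<lambda>x. norm (case x of (k, n) \<Rightarrow> F k n)) summable_on UNIV \<times> UNIV"
  proof (rule Infinite_Sum.abs_summable_on_Sigma_iff[THEN iffD2, OF conjI])
    show "\<forall>k\<in>UNIV. (\<lambda>n. norm (case (k, n) of (k, n) \<Rightarrow> F k n)) summable_on UNIV"
      using inner' by simp
    show "(\<lambda>k. norm (\<Sum>\<^sub>\<infinity>n. norm (case (k, n) of (k, n) \<Rightarrow> F k n))) summable_on UNIV"
      using outer by (auto simp: eq inner' suminf_nonneg inner intro!: norm_summable_imp_summable_on)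
  qed
  then have sm: "(\<lambda>(k, n). F k n) summable_on UNIV \<times> UNIV"
    by (rule abs_summable_summable)
  then have sm': "(\<lambda>(n, k). F k n) summable_on UNIV \<times> UNIV"
    by (subst summable_on_swap) (simp add: case_prod_unfold prod.swap_def)
  have col: "(\<lambda>k. F k n) summable_on UNIV" for n
    using summable_on_Sigma_banach[OF sm'] summable_on_SigmaD1[OF sm'] by auto
  have "(\<Sum>k. \<Sum>n. F k n) = (\<Sum>\<^sub>\<infinity>k. \<Sum>\<^sub>\<infinity>n. F k n)"
    using summable_on_Sigma_banach[OF sm] abs_summable_summable[OF inner'] by (simp add: eq)
  also have "\<dots> = (\<Sum>\<^sub>\<infinity>n. \<Sum>\<^sub>\<infinity>k. F k n)"
    by (rule infsum_swap_banach[OF sm])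
  also have "\<dots> = (\<Sum>n. \<Sum>k. F k n)"
    using summable_on_Sigma_banach[OF sm'] col by (simp add: eq)
  finally show ?thesis .
qed

text \<open>At index 0 this is 0, because \<open>0 powr x = 0\<close>.\<close>

definition log_powr :: "real \<Rightarrow> nat \<Rightarrow> nat \<Rightarrow> real" where
  "log_powr \<sigma> k n = real n powr (- \<sigma>) * (- ln (real n)) ^ k"

text \<open>For \<sigma> > 1/2 this is the k-th derivative at \<sigma> of the Dirichlet series of
  \<open>f\<close>.\<close>

definition log_moment :: "real \<Rightarrow> nat \<Rightarrow> h2 \<Rightarrow> complex" where
  "log_moment \<sigma> k f = (\<Sum>n. h2_coeff f n * of_real (log_powr \<sigma> k n))"

lemma log_powr_0 [simp]: "log_powr \<sigma> k 0 = 0"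
  by (simp add: log_powr_def)

text \<open>A single term of the exponential series is at most its sum.\<close>

lemma power_le_fact_exp:
  fixes x :: real
  assumes "x \<ge> 0"
  shows "x ^ k \<le> fact k * exp x"
proof -
  have "x ^ k / fact k = (\<Sum>n\<in>{k}. inverse (fact n) * x ^ n)"
    by (simp add: field_simps)
  also have "\<dots> \<le> (\<Sum>n. inverse (fact n) * x ^ n)"
    using assms summable_exp[of x] by (intro sum_le_suminf) auto
  also have "\<dots> = exp x"
    by (simp add: exp_def scaleR_conv_of_real divide_inverse)
  finally show ?thesis
    by (simp add: field_simps)
qed

text \<open>\<open>power_le_fact_exp\<close> at \<open>\<delta> * ln (real n)\<close> trades the
  logarithms for a factor \<open>real n powr \<delta>\<close>. The \<open>fact k\<close> is later
  cancelled by the Taylor denominator, which leaves only the geometric growth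
  \<open>1 / \<delta> ^ k\<close>.\<close>

lemma abs_log_powr_le:
  assumes "\<delta> > 0"
  shows "\<bar>log_powr \<sigma> k n\<bar> \<le> fact k / \<delta> ^ k * real n powr (\<delta> - \<sigma>)"
proof (cases "n = 0")
  case False
  have "(\<delta> * ln (real n)) ^ k \<le> fact k * exp (\<delta> * ln (real n))"
    using assms False by (intro power_le_fact_exp) auto
  then have "ln (real n) ^ k \<le> fact k / \<delta> ^ k * real n powr \<delta>"
    using assms False by (simp add: powr_def field_simps power_mult_distrib)
  then have "real n powr (- \<sigma>) * ln (real n) ^ k
      \<le> real n powr (- \<sigma>) * (fact k / \<delta> ^ k * real n powr \<delta>)"
    by (rule mult_left_mono) simp
  also have "\<dots> = fact k / \<delta> ^ k * (real n powr (- \<sigma>) * real n powr \<delta>)"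
    by simp
  also have "real n powr (- \<sigma>) * real n powr \<delta> = real n powr (\<delta> - \<sigma>)"
    by (simp flip: powr_add)
  finally show ?thesis
    using False by (simp add: log_powr_def abs_mult power_abs)
qed simp

lemma log_powr_l2_bound:
  assumes "\<delta> > 0" "\<sigma> - \<delta> > 1/2"
  shows "summable (\<lambda>n. (log_powr \<sigma> k n)\<^sup>2)"
    and "(\<Sum>n. (log_powr \<sigma> k n)\<^sup>2)
      \<le> (fact k / \<delta> ^ k)\<^sup>2 * (\<Sum>n. real n powr (2 * (\<delta> - \<sigma>)))"
proof -
  have 1: "(log_powr \<sigma> k n)\<^sup>2 \<le> (fact k / \<delta> ^ k)\<^sup>2 * real n powr (2 * (\<delta> - \<sigma>))" for n
  proof -
    have "(log_powr \<sigma> k n)\<^sup>2 \<le> (fact k / \<delta> ^ k * real n powr (\<delta> - \<sigma>))\<^sup>2"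
      using power_mono[OF abs_log_powr_le[OF assms(1), of \<sigma> k n], of 2] by simp
    also have "\<dots> = (fact k / \<delta> ^ k)\<^sup>2 * (real n powr (\<delta> - \<sigma>))\<^sup>2"
      by (simp only: power_mult_distrib)
    also have "(real n powr (\<delta> - \<sigma>))\<^sup>2 = real n powr (2 * (\<delta> - \<sigma>))"
      by (simp add: power2_eq_square flip: powr_add)
    finally show ?thesis .
  qed
  have sm: "summable (\<lambda>n. real n powr (2 * (\<delta> - \<sigma>)))"
    using assms by (simp add: summable_real_powr_iff)
  show 2: "summable (\<lambda>n. (log_powr \<sigma> k n)\<^sup>2)"
    by (rule summable_comparison_test'[OF summable_mult[OF sm], of 0]) (use 1 in auto)
  show "(\<Sum>n. (log_powr \<sigma> k n)\<^sup>2)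
      \<le> (fact k / \<delta> ^ k)\<^sup>2 * (\<Sum>n. real n powr (2 * (\<delta> - \<sigma>)))"
    unfolding suminf_mult[OF sm, symmetric] by (rule suminf_le[OF 1 2 summable_mult[OF sm]])
qed

lemma summable_log_powr_power2:
  assumes "\<sigma> > 1/2"
  shows "summable (\<lambda>n. (log_powr \<sigma> k n)\<^sup>2)"
  \<comment> \<open>Half the gap between \<sigma> and 1/2 is an admissible loss in the
    exponent.\<close>
  by (rule log_powr_l2_bound(1)[of "(\<sigma> - 1/2) / 2"]) (use assms in \<open>simp_all add: field_simps\<close>)

lemma
  assumes "\<sigma> > 1/2"
  shows summable_log_moment: "summable (\<lambda>n. cmod (h2_coeff f n * of_real (log_powr \<sigma> k n)))"
    and suminf_log_moment_le: "(\<Sum>n. cmod (h2_coeff f n * of_real (log_powr \<sigma> k n)))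
      \<le> norm f * sqrt (\<Sum>n. (log_powr \<sigma> k n)\<^sup>2)"
  using summable_norm_mult[OF summable_h2_coeff[of f], of "\<lambda>n. of_real (log_powr \<sigma> k n)"]
    cauchy_schwarz_suminf[OF summable_h2_coeff[of f], of "\<lambda>n. of_real (log_powr \<sigma> k n)"]
    summable_log_powr_power2[OF assms, of k]
  by (simp_all add: norm_mult norm_h2)

lemma norm_log_moment_le:
  assumes "\<sigma> > 1/2"
  shows "cmod (log_moment \<sigma> k f) \<le> norm f * sqrt (\<Sum>n. (log_powr \<sigma> k n)\<^sup>2)"
  unfolding log_moment_def
  using summable_norm[OF summable_log_moment[OF assms]] suminf_log_moment_le[OF assms]
  by (rule order_trans)

section \<open>Values of the zeta function and its derivative\<close>

lemma of_nat_powr_minus_of_real: "of_nat n powr (- complex_of_real x) = of_real (real n powr (- x))"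
  using powr_of_real[of "real n" "- x"] by simp

text \<open>The squares of \<open>log_powr \<sigma> 0 n\<close> are the terms of the zeta series at
  \<open>2 * \<sigma>\<close>; the zero entry at index 0 absorbs the index shift.\<close>

lemma zeta_of_real:
  assumes "\<sigma> > 1/2"
  shows "zeta (of_real (2 * \<sigma>)) = of_real (\<Sum>n. (log_powr \<sigma> 0 n)\<^sup>2)"
proof -
  have sq: "(log_powr \<sigma> 0 n)\<^sup>2 = real n powr (- (2 * \<sigma>))" for n
    by (simp add: log_powr_def power2_eq_square flip: powr_add)
  have sm: "summable (\<lambda>n. (log_powr \<sigma> 0 n)\<^sup>2)"
    using assms by (rule summable_log_powr_power2)
  have "zeta (of_real (2 * \<sigma>)) = (\<Sum>n. of_real ((log_powr \<sigma> 0 (Suc n))\<^sup>2))"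
    unfolding zeta_def sq of_nat_powr_minus_of_real ..
  also have "\<dots> = of_real (\<Sum>n. (log_powr \<sigma> 0 (Suc n))\<^sup>2)"
    using sm summable_Suc_iff[of "\<lambda>n. (log_powr \<sigma> 0 n)\<^sup>2"]
    by (intro suminf_of_real[symmetric]) simp
  also have "(\<Sum>n. (log_powr \<sigma> 0 (Suc n))\<^sup>2) = (\<Sum>n. (log_powr \<sigma> 0 n)\<^sup>2)"
    using suminf_split_head[OF sm] by simp
  finally show ?thesis .
qed

lemma summable_log_powr_mult:
  assumes "\<sigma> > 1/2"
  shows "summable (\<lambda>n. \<bar>log_powr \<sigma> k n * log_powr \<sigma> l n\<bar>)"
  using summable_norm_mult[of "\<lambda>n. of_real (log_powr \<sigma> k n)" "\<lambda>n. of_real (log_powr \<sigma> l n)"]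
    summable_log_powr_power2[OF assms] by (simp add: abs_mult)

text \<open>Termwise differentiation, justified by the Weierstrass M-test on a half-plane; the
  differentiated terms at \<open>2 * \<sigma>\<close> are the products of the two
  \<open>log_powr\<close> entries.\<close>

lemma deriv_zeta_of_real:
  assumes "\<sigma> > 1/2"
  shows "deriv zeta (of_real (2 * \<sigma>)) = of_real (\<Sum>n. log_powr \<sigma> 0 n * log_powr \<sigma> 1 n)"
proof -
  \<comment> \<open>A midpoint: \<open>2 * \<sigma>\<close> is interior to the half-plane
    \<open>S\<close>, while the differentiated series still converges absolutely at
    \<open>2 * \<tau>\<close> and supplies the majorant.\<close>
  define \<tau> where "\<tau> = (\<sigma> + 1/2) / 2"
  have \<tau>: "\<tau> > 1/2" "2 * \<tau> < 2 * \<sigma>"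
    using assms by (auto simp: \<tau>_def field_simps)
  define S where "S = {s. Re s > 2 * \<tau>}"
  define f' where "f' n s = - of_real (ln (real (Suc n))) * of_nat (Suc n) powr (- s)"
    for n and s :: complex
  have prod: "log_powr x 0 n * log_powr x 1 n = - ln (real n) * real n powr (- (2 * x))" for x n
    by (simp add: log_powr_def flip: powr_add)
  have f': "f' n (of_real (2 * x)) = of_real (log_powr x 0 (Suc n) * log_powr x 1 (Suc n))" for n x
    unfolding prod f'_def of_nat_powr_minus_of_real by simp
  have "summable (\<lambda>n. \<bar>log_powr \<tau> 0 (Suc n) * log_powr \<tau> 1 (Suc n)\<bar>)"
    using summable_log_powr_mult[OF \<tau>(1)] by (subst summable_Suc_iff)
  moreover have "norm (f' n s) \<le> \<bar>log_powr \<tau> 0 (Suc n) * log_powr \<tau> 1 (Suc n)\<bar>"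
    if "s \<in> S" for n s
  proof -
    have "norm (f' n s) = ln (real (Suc n)) * real (Suc n) powr (- Re s)"
      unfolding f'_def by (simp add: norm_mult norm_powr_real_powr del: of_nat_Suc)
    also have "\<dots> \<le> ln (real (Suc n)) * real (Suc n) powr (- (2 * \<tau>))"
      using that by (intro mult_left_mono powr_mono) (auto simp: S_def)
    finally show ?thesis
      unfolding prod by (simp add: abs_mult)
  qed
  ultimately have unif: "uniformly_convergent_on S (\<lambda>n s. \<Sum>i<n. f' i s)"
    by (intro Weierstrass_m_test'[where M = "\<lambda>n. \<bar>log_powr \<tau> 0 (Suc n) * log_powr \<tau> 1 (Suc n)\<bar>"])
  have "(zeta has_field_derivative (\<Sum>n. f' n (of_real (2 * \<sigma>)))) (at (of_real (2 * \<sigma>)))"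
    unfolding zeta_def[abs_def]
  proof (rule has_field_derivative_series'(2)[OF _ _ unif])
    show "convex S"
      unfolding S_def by (rule convex_halfspace_Re_gt)
    show "((\<lambda>s. of_nat (Suc n) powr (- s)) has_field_derivative f' n s) (at s within S)" for n s
      using has_field_derivative_at_within[OF DERIV_chain2[OF
          has_field_derivative_powr_right[of "of_nat (Suc n)" "- s"] DERIV_minus[OF DERIV_ident]]]
      unfolding f'_def by (simp add: Ln_of_nat del: of_nat_Suc)
    show "of_real (2 * \<sigma>) \<in> S" "of_real (2 * \<sigma>) \<in> interior S"
      using \<tau> by (simp_all add: S_def interior_open open_halfspace_Re_gt)
    have "summable (\<lambda>n. real n powr (- (2 * \<sigma>)))"
      using assms by (simp add: summable_real_powr_iff)
    then show "summable (\<lambda>n. of_nat (Suc n) powr (- complex_of_real (2 * \<sigma>)))"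
      unfolding of_nat_powr_minus_of_real by (subst summable_of_real_iff, subst summable_Suc_iff)
  qed
  then have "deriv zeta (of_real (2 * \<sigma>)) = (\<Sum>n. f' n (of_real (2 * \<sigma>)))"
    by (rule DERIV_imp_deriv)
  also have "\<dots> = of_real (\<Sum>n. log_powr \<sigma> 0 (Suc n) * log_powr \<sigma> 1 (Suc n))"
    unfolding f' using summable_rabs_cancel[OF summable_log_powr_mult[OF assms, of 0 1]]
    by (intro suminf_of_real[symmetric]) (subst summable_Suc_iff)
  also have "(\<Sum>n. log_powr \<sigma> 0 (Suc n) * log_powr \<sigma> 1 (Suc n))
      = (\<Sum>n. log_powr \<sigma> 0 n * log_powr \<sigma> 1 n)"
    using suminf_split_head[OF summable_rabs_cancel[OF summable_log_powr_mult[OF assms, of 0 1]]]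
    by simp
  finally show ?thesis .
qed

text \<open>The cross term is split by a weighted AM-GM inequality whose weight leaves enough of the
  budget \<open>S * Z * y\<^sup>2\<close> to absorb \<open>S\<^sup>2 * Q * y\<^sup>2\<close>. The
  price is the last term of the constant, quadratic in \<open>S\<close>.\<close>

lemma rank_two_form_le:
  fixes Z P Q S u y :: real
  assumes "Z > 0" "Q \<ge> 0" "S \<ge> 0" "2 * S * Q \<le> Z"
  shows "Z * u\<^sup>2 + 2 * S * P * u * y + S\<^sup>2 * Q * y\<^sup>2
    \<le> (Z + S * P\<^sup>2 / Z + 2 * S\<^sup>2 * P\<^sup>2 * Q / Z\<^sup>2) * (u\<^sup>2 + S * y\<^sup>2)"
proof -
  \<comment> \<open>\<open>q\<close> is the share of the budget \<open>S * Z\<close> that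
    \<open>S\<^sup>2 * Q\<close> takes up; for \<open>q \<le> 1/2\<close> the number
    \<open>t\<close> dominates \<open>1 / (1 - q)\<close>.\<close>
  define q where "q = S * Q / Z"
  define t where "t = 1 + 2 * q"
  have q: "0 \<le> q" "q \<le> 1/2"
    using assms by (auto simp: q_def field_simps)
  have t: "t > 0"
    using q by (simp add: t_def)
  have SQ: "S * Q = q * Z"
    using assms by (simp add: q_def)
  have "0 \<le> q * (1 - 2 * q)"
    using q by simp
  then have "1 \<le> (1 - q) * t"
    by (simp add: t_def algebra_simps power2_eq_square)
  then have 1: "1 / t \<le> 1 - q"
    using t by (simp add: field_simps)
  \<comment> \<open>Dividing this square by \<open>Z * t\<close> gives the AM-GM inequality for the
    cross term.\<close>
  have "0 \<le> (P * t * u - Z * y)\<^sup>2"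
    by simp
  then have "2 * P * u * y \<le> P\<^sup>2 * t / Z * u\<^sup>2 + Z / t * y\<^sup>2"
    using t \<open>Z > 0\<close> by (simp add: field_simps power2_eq_square)
  also have "\<dots> \<le> P\<^sup>2 * t / Z * u\<^sup>2 + Z * (1 - q) * y\<^sup>2"
    using mult_left_mono[OF 1, of Z] \<open>Z > 0\<close> by (intro add_left_mono mult_right_mono) auto
  finally have "S * (2 * P * u * y) \<le> S * (P\<^sup>2 * t / Z * u\<^sup>2 + Z * (1 - q) * y\<^sup>2)"
    using \<open>S \<ge> 0\<close> by (rule mult_left_mono)
  \<comment> \<open>The withheld part \<open>q * Z\<close> equals \<open>S * Q\<close>, so the
    negative term here cancels the last term of the form.\<close>
  also have "\<dots> = S * P\<^sup>2 * t / Z * u\<^sup>2 + S * Z * y\<^sup>2 - S * (S * Q) * y\<^sup>2"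
    unfolding SQ by (simp add: algebra_simps)
  finally have "Z * u\<^sup>2 + 2 * S * P * u * y + S\<^sup>2 * Q * y\<^sup>2
      \<le> (Z + S * P\<^sup>2 * t / Z) * u\<^sup>2 + Z * (S * y\<^sup>2)"
    by (simp add: algebra_simps power2_eq_square)
  also have "\<dots> \<le> (Z + S * P\<^sup>2 * t / Z) * u\<^sup>2 + (Z + S * P\<^sup>2 * t / Z) * (S * y\<^sup>2)"
    using assms t by (intro add_left_mono mult_right_mono) auto
  also have "\<dots> = (Z + S * P\<^sup>2 / Z + 2 * S\<^sup>2 * P\<^sup>2 * Q / Z\<^sup>2) * (u\<^sup>2 + S * y\<^sup>2)"
    using \<open>Z > 0\<close> by (simp add: t_def q_def field_simps power2_eq_square)
  finally show ?thesis .
qed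

section \<open>Powers of a Dirichlet polynomial supported on primes\<close>

lemma has_sum_sum_finite:
  fixes f :: "'i \<Rightarrow> 'a \<Rightarrow> 'b :: topological_comm_monoid_add"
  assumes "finite J" "\<And>j. j \<in> J \<Longrightarrow> (f j has_sum S j) A"
  shows "((\<lambda>x. \<Sum>j\<in>J. f j x) has_sum (\<Sum>j\<in>J. S j)) A"
  using assms by (induction J rule: finite_induct) (auto intro!: has_sum_add)

text \<open>Multiplying a Dirichlet series by q^(-s) moves its coefficients from n to q n; this is a
  reindexing along an injection, and non-multiples of q contribute 0.\<close>

lemma has_sum_dvd_div:
  fixes h :: "nat \<Rightarrow> 'b :: {comm_monoid_add, topological_space}"
  assumes "(h has_sum S) UNIV" "q > 0"
  shows "((\<lambda>m. if q dvd m then h (m div q) else 0) has_sum S) UNIV"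
proof -
  have "inj ((*) q)"
    using \<open>q > 0\<close> by (auto simp: inj_def)
  then have "((\<lambda>m. if q dvd m then h (m div q) else 0) has_sum S) (range ((*) q))"
    using assms by (subst has_sum_reindex) (simp_all add: o_def)
  then show ?thesis
    by (subst (asm) has_sum_cong_neutral[where T = UNIV
          and g = "\<lambda>m. if q dvd m then h (m div q) else 0"])
       (auto elim!: dvdE)
qed

lemma sum_power2_le_power2_sum:
  fixes f :: "'a \<Rightarrow> real"
  assumes "finite A" "\<And>x. x \<in> A \<Longrightarrow> f x \<ge> 0"
  shows "(\<Sum>x\<in>A. (f x)\<^sup>2) \<le> (\<Sum>x\<in>A. f x)\<^sup>2"
proof -
  have "(\<Sum>x\<in>A. (f x)\<^sup>2) \<le> (\<Sum>x\<in>A. f x * (\<Sum>y\<in>A. f y))"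
    unfolding power2_eq_square
    by (intro sum_mono mult_left_mono member_le_sum assms) auto
  then show ?thesis
    by (simp add: power2_eq_square sum_distrib_right)
qed

locale prime_symbol =
  fixes J :: "'i set" and p :: "'i \<Rightarrow> nat" and r :: "'i \<Rightarrow> real"
  assumes finite_J: "finite J"
    and prime_p: "\<And>j. j \<in> J \<Longrightarrow> prime (p j)"
    and inj_p: "inj_on p J"
    and r_nonneg: "\<And>j. j \<in> J \<Longrightarrow> r j \<ge> 0"
begin

text \<open>\<open>coeff_pow k m\<close> is the coefficient of \<open>m\<^sup>-\<^sup>s\<close> in the \<open>k\<close>-th power of \<open>\<Sum>j\<in>J. r j p\<^sub>j\<^sup>-\<^sup>s\<close>.\<close>

primrec coeff_pow :: "nat \<Rightarrow> nat \<Rightarrow> real" where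
  "coeff_pow 0 m = (if m = 1 then 1 else 0)"
| "coeff_pow (Suc k) m = (\<Sum>j\<in>J. if p j dvd m then r j * coeff_pow k (m div p j) else 0)"

lemma coeff_pow_nonneg: "coeff_pow k m \<ge> 0"
  by (induction k arbitrary: m) (auto intro!: sum_nonneg mult_nonneg_nonneg r_nonneg)

text \<open>The weight m^(-s) evaluates the k-th power of the Dirichlet polynomial, and the constant
  weight 1 gives the total mass R^k of its coefficients. Complete multiplicativity drives the
  induction: removing a prime \<open>p j\<close> from m splits off the factor
  \<open>w (p j)\<close>.\<close>

lemma has_sum_coeff_pow:
  fixes w :: "nat \<Rightarrow> 'a :: real_normed_field"
  assumes w1: "w 1 = 1" and w_mult: "\<And>m n. w (m * n) = w m * w n"
  shows "((\<lambda>m. of_real (coeff_pow k m) * w m) has_sum (\<Sum>j\<in>J. of_real (r j) * w (p j)) ^ k) UNIV"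
proof (induction k)
  case 0
  show ?case
    by (rule has_sum_finite_neutralI[of "{1}"]) (use w1 in auto)
next
  case (Suc k)
  let ?X = "\<Sum>j\<in>J. of_real (r j) * w (p j)"
  have "((\<lambda>m. \<Sum>j\<in>J. if p j dvd m
          then of_real (r j) * w (p j) * (of_real (coeff_pow k (m div p j)) * w (m div p j)) else 0)
      has_sum (\<Sum>j\<in>J. of_real (r j) * w (p j) * ?X ^ k)) UNIV"
    using prime_p by (intro has_sum_sum_finite finite_J has_sum_dvd_div has_sum_cmult_right Suc.IH)
      (simp add: prime_gt_0_nat)
  also have "(\<Sum>j\<in>J. of_real (r j) * w (p j) * ?X ^ k) = ?X ^ Suc k"
    by (simp add: sum_distrib_right)
  also have "(\<lambda>m. \<Sum>j\<in>J. if p j dvd m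
          then of_real (r j) * w (p j) * (of_real (coeff_pow k (m div p j)) * w (m div p j)) else 0)
      = (\<lambda>m. of_real (coeff_pow (Suc k) m) * w m)"
    unfolding coeff_pow.simps of_real_sum sum_distrib_right
    by (intro ext sum.cong) (auto simp: w_mult dest: prime_p elim!: dvdE)
  finally show ?case .
qed

text \<open>Each recursion step removes exactly one prime factor. Consequently the supports for
  different k are disjoint, which makes the powers orthogonal.\<close>

lemma coeff_pow_neq_0:
  assumes "coeff_pow k m \<noteq> 0"
  shows "m > 0 \<and> size (prime_factorization m) = k"
  using assms
proof (induction k arbitrary: m)
  case 0
  then show ?case by (simp split: if_splits)
next
  case (Suc k)
  then obtain j where j: "j \<in> J" "p j dvd m" "coeff_pow k (m div p j) \<noteq> 0"
    by (auto elim!: sum.not_neutral_contains_not_neutral split: if_splits)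
  then obtain n where n: "m = p j * n"
    by (auto elim: dvdE)
  have "prime (p j)" "coeff_pow k n \<noteq> 0"
    using j n prime_p[of j] by (auto dest: prime_gt_0_nat)
  then show ?case
    using Suc.IH[of n] by (simp add: n prime_factorization_mult prime_factorization_prime prime_gt_0_nat)
qed

text \<open>With the constant weight 1 the full sum is the right-hand side, and the terms are
  nonnegative.\<close>

lemma sum_coeff_pow_le:
  assumes "finite A"
  shows "(\<Sum>m\<in>A. coeff_pow k m) \<le> (\<Sum>j\<in>J. r j) ^ k"
  using has_sum_coeff_pow[of "\<lambda>_. 1 :: real" k] assms
  by (intro finite_sum_le_has_sum) (auto intro: coeff_pow_nonneg)

text \<open>Distinctness of the primes enters here: no other \<open>p i\<close> divides
  \<open>p j\<close>, so no two of the \<open>r j\<close> merge into one coefficient.\<close>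

lemma coeff_pow_1_eq:
  assumes "j \<in> J"
  shows "coeff_pow 1 (p j) = r j"
proof -
  have "coeff_pow 1 (p j) = (\<Sum>i\<in>J. if i = j then r j else 0)"
    unfolding One_nat_def coeff_pow.simps
  proof (rule sum.cong)
    fix i assume "i \<in> J"
    show "(if p i dvd p j then r i * (if p j div p i = Suc 0 then 1 else 0) else 0)
        = (if i = j then r j else 0)"
      using primes_dvd_imp_eq[OF prime_p[OF \<open>i \<in> J\<close>] prime_p[OF assms]]
        inj_onD[OF inj_p, OF _ \<open>i \<in> J\<close> assms] prime_gt_0_nat[OF prime_p[OF assms]] by auto
  qed simp
  then show ?thesis
    using finite_J assms by simp
qed

lemma coeff_pow_1_neq_0:
  assumes "coeff_pow 1 m \<noteq> 0"
  shows "m \<in> p ` J"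
proof -
  obtain j where "j \<in> J" "p j dvd m" "m div p j = 1"
    using assms by (auto elim!: sum.not_neutral_contains_not_neutral split: if_splits)
  then show ?thesis
    by (metis dvd_mult_div_cancel image_eqI mult.right_neutral)
qed

text \<open>Only the integers \<open>p j\<close> carry nonzero coefficients, and injectivity of
  \<open>p\<close> turns a sum over them into a sum over \<open>J\<close>.\<close>

lemma sum_coeff_pow_1_power2_le:
  assumes "finite A"
  shows "(\<Sum>m\<in>A. (coeff_pow 1 m)\<^sup>2) \<le> (\<Sum>j\<in>J. (r j)\<^sup>2)"
proof -
  have "(\<Sum>m\<in>A. (coeff_pow 1 m)\<^sup>2) = (\<Sum>m\<in>A \<inter> p ` J. (coeff_pow 1 m)\<^sup>2)"
    using assms coeff_pow_1_neq_0 by (intro sum.mono_neutral_right) auto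
  also have "\<dots> \<le> (\<Sum>m\<in>p ` J. (coeff_pow 1 m)\<^sup>2)"
    using finite_J by (intro sum_mono2) auto
  also have "\<dots> = (\<Sum>j\<in>J. (r j)\<^sup>2)"
    using coeff_pow_1_eq by (subst sum.reindex[OF inj_p]) simp
  finally show ?thesis .
qed

end

section \<open>The contribution of the first two moments\<close>

lemma log_moment_pair_le:
  assumes \<sigma>: "\<sigma> > 1/2" and "S \<ge> 0"
    and Z: "Z = (\<Sum>n. (log_powr \<sigma> 0 n)\<^sup>2)" and P: "P = - (\<Sum>n. log_powr \<sigma> 0 n * log_powr \<sigma> 1 n)"
    and Q: "Q = (\<Sum>n. (log_powr \<sigma> 1 n)\<^sup>2)" and SQ: "2 * S * Q \<le> Z"
  shows "(cmod (log_moment \<sigma> 0 f))\<^sup>2 + S * (cmod (log_moment \<sigma> 1 f))\<^sup>2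
    \<le> (Z + S * P\<^sup>2 / Z + 2 * S\<^sup>2 * P\<^sup>2 * Q / Z\<^sup>2) * (norm f)\<^sup>2"
    (is "?N \<le> ?M * _")
proof -
  \<comment> \<open>The left-hand side \<open>N\<close> is the pairing of \<open>f\<close> with the vector \<open>v\<close> built from its own two moments,
      and \<open>\<parallel>v\<parallel>\<^sup>2 \<le> M N\<close>; Cauchy--Schwarz then gives \<open>N\<^sup>2 \<le> M N \<parallel>f\<parallel>\<^sup>2\<close>.\<close>
  define u where "u = log_moment \<sigma> 0 f"
  define y where "y = log_moment \<sigma> 1 f"
  define v where "v n = of_real (log_powr \<sigma> 0 n) * cnj u + of_real (S * log_powr \<sigma> 1 n) * cnj y" for n
  define B where "B n = (log_powr \<sigma> 0 n)\<^sup>2 * (cmod u)\<^sup>2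
      + 2 * S * cmod u * cmod y * (- (log_powr \<sigma> 0 n * log_powr \<sigma> 1 n))
      + S\<^sup>2 * (cmod y)\<^sup>2 * (log_powr \<sigma> 1 n)\<^sup>2" for n
  \<comment> \<open>Because of this sign the product of the absolute values is minus the product, so
    the cross terms sum to a multiple of \<open>P\<close>.\<close>
  have neg: "log_powr \<sigma> 0 n * log_powr \<sigma> 1 n \<le> 0" for n
    by (cases "n = 0") (auto simp: log_powr_def mult_nonneg_nonneg)
  have sm0: "summable (\<lambda>n. (log_powr \<sigma> 0 n)\<^sup>2)" and sm1: "summable (\<lambda>n. (log_powr \<sigma> 1 n)\<^sup>2)"
    using \<sigma> by (auto intro: summable_log_powr_power2)
  have sm01: "summable (\<lambda>n. log_powr \<sigma> 0 n * log_powr \<sigma> 1 n)"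
    using summable_log_powr_mult[OF \<sigma>] by (rule summable_rabs_cancel)
  have v_le: "(cmod (v n))\<^sup>2 \<le> B n" for n
  proof -
    have "cmod (v n) \<le> \<bar>log_powr \<sigma> 0 n\<bar> * cmod u + S * \<bar>log_powr \<sigma> 1 n\<bar> * cmod y"
      unfolding v_def by (rule order_trans[OF norm_triangle_ineq])
        (use \<open>S \<ge> 0\<close> in \<open>simp add: norm_mult abs_mult\<close>)
    then have "(cmod (v n))\<^sup>2 \<le> (\<bar>log_powr \<sigma> 0 n\<bar> * cmod u + S * \<bar>log_powr \<sigma> 1 n\<bar> * cmod y)\<^sup>2"
      by (rule power_mono) simp
    also have "\<dots> = \<bar>log_powr \<sigma> 0 n\<bar>\<^sup>2 * (cmod u)\<^sup>2
        + 2 * S * cmod u * cmod y * (\<bar>log_powr \<sigma> 0 n\<bar> * \<bar>log_powr \<sigma> 1 n\<bar>)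
        + S\<^sup>2 * (cmod y)\<^sup>2 * \<bar>log_powr \<sigma> 1 n\<bar>\<^sup>2"
      by (simp only: power2_sum power_mult_distrib) (simp only: mult_ac)
    also have "\<dots> = B n"
      using neg[of n] unfolding B_def by (simp flip: abs_mult)
    finally show ?thesis .
  qed
  have B: "B sums (Z * (cmod u)\<^sup>2 + 2 * S * cmod u * cmod y * P + S\<^sup>2 * (cmod y)\<^sup>2 * Q)"
    unfolding B_def Z P Q
    by (intro sums_add sums_mult sums_mult2 sums_minus summable_sums sm0 sm1 sm01)
  have sm_v: "summable (\<lambda>n. (cmod (v n))\<^sup>2)"
    by (rule summable_comparison_test'[OF sums_summable[OF B], of 0]) (use v_le in auto)
  have "Z > 0"
    \<comment> \<open>Positivity comes from the entry at index 1, which is 1.\<close>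
    unfolding Z using sm0 by (rule suminf_pos2[of _ 1]) (auto simp: log_powr_def)
  have "Q \<ge> 0"
    unfolding Q using sm1 by (rule suminf_nonneg) auto
  have "(\<Sum>n. (cmod (v n))\<^sup>2) \<le> suminf B"
    by (rule suminf_le[OF v_le sm_v sums_summable[OF B]])
  also have "\<dots> = Z * (cmod u)\<^sup>2 + 2 * S * P * cmod u * cmod y + S\<^sup>2 * Q * (cmod y)\<^sup>2"
    using B by (simp add: sums_iff mult_ac)
  also have "\<dots> \<le> ?M * ((cmod u)\<^sup>2 + S * (cmod y)\<^sup>2)"
    by (rule rank_two_form_le) fact+
  finally have v2: "(\<Sum>n. (cmod (v n))\<^sup>2) \<le> ?M * ?N"
    by (simp add: u_def y_def)
  have N_nonneg: "?N \<ge> 0"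
    using \<open>S \<ge> 0\<close> by simp
  have moment: "(\<lambda>n. h2_coeff f n * of_real (log_powr \<sigma> k n)) sums log_moment \<sigma> k f" for k
    unfolding log_moment_def
    by (intro summable_sums summable_norm_cancel[OF summable_log_moment[OF \<sigma>]])
  have "of_real ?N = u * cnj u + of_real S * cnj y * y"
    by (simp only: u_def y_def of_real_add of_real_mult complex_norm_square mult_ac)
  also have "\<dots> = (\<Sum>n. h2_coeff f n * of_real (log_powr \<sigma> 0 n) * cnj u
      + of_real S * cnj y * (h2_coeff f n * of_real (log_powr \<sigma> 1 n)))"
    unfolding u_def y_def by (intro sums_unique sums_add sums_mult sums_mult2 moment)
  also have "\<dots> = (\<Sum>n. h2_coeff f n * v n)"
    by (simp add: v_def algebra_simps)
  finally have "?N = cmod (\<Sum>n. h2_coeff f n * v n)"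
    using N_nonneg by (metis abs_of_nonneg norm_of_real)
  also have "\<dots> \<le> (\<Sum>n. cmod (h2_coeff f n) * cmod (v n))"
    using summable_norm[of "\<lambda>n. h2_coeff f n * v n"] summable_norm_mult[OF summable_h2_coeff[of f] sm_v]
    by (simp add: norm_mult)
  also have "\<dots> \<le> norm f * sqrt (\<Sum>n. (cmod (v n))\<^sup>2)"
    unfolding norm_h2 by (rule cauchy_schwarz_suminf[OF summable_h2_coeff sm_v])
  finally have "?N\<^sup>2 \<le> (norm f * sqrt (\<Sum>n. (cmod (v n))\<^sup>2))\<^sup>2"
    using N_nonneg by (rule power_mono)
  also have "\<dots> = (norm f)\<^sup>2 * (\<Sum>n. (cmod (v n))\<^sup>2)"
    by (simp add: power_mult_distrib suminf_nonneg sm_v)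
  also have "\<dots> \<le> (norm f)\<^sup>2 * (?M * ?N)"
    using v2 by (rule mult_left_mono) simp
  finally have "?N * ?N \<le> (?M * (norm f)\<^sup>2) * ?N"
    by (simp add: power2_eq_square mult_ac)
  moreover have "0 \<le> ?M * (norm f)\<^sup>2"
    using \<open>Z > 0\<close> \<open>Q \<ge> 0\<close> \<open>S \<ge> 0\<close> by simp
  \<comment> \<open>One factor \<open>?N\<close> is cancelled; if it vanishes, the claim is
    immediate.\<close>
  ultimately show ?thesis
    using N_nonneg by (cases "?N = 0") (auto simp: mult_le_cancel_right)
qed

section \<open>The composition operator\<close>

text \<open>\<delta> is the part of the exponent spent on dominating logarithms. The bound
  \<delta>/2 keeps the ratio R/\<delta> of all geometric series below at most 1/2.\<close>

locale small_prime_symbol = prime_symbol J p r for J :: "'i set" and p r +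
  fixes \<sigma> \<delta> :: real
  assumes delta: "\<delta> > 0" "\<sigma> - \<delta> > 1/2"
    and r_small: "(\<Sum>j\<in>J. r j) \<le> \<delta> / 2"
begin

definition total :: real where "total = (\<Sum>j\<in>J. r j)"

definition symb :: "complex \<Rightarrow> complex" where
  "symb s = of_real \<sigma> + (\<Sum>j\<in>J. of_real (r j) * of_nat (p j) powr (- s))"

text \<open>This is the value of zeta at \<open>2 * (\<sigma> - \<delta>)\<close>.\<close>

definition majorant :: real where "majorant = (\<Sum>n. real n powr (2 * (\<delta> - \<sigma>)))"

text \<open>Since the supports of the powers are disjoint, only the power k equal to the number of
  prime factors of m can reach the coefficient at m, so no sum over k appears. At m = 0 the value is
  0, as the type \<open>h2\<close> requires.\<close>

definition image_coeff :: "h2 \<Rightarrow> nat \<Rightarrow> complex" where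
  "image_coeff f m = (let k = size (prime_factorization m)
     in of_real (coeff_pow k m / fact k) * log_moment \<sigma> k f)"

lemma sigma_gt: "\<sigma> > 1/2"
  using delta by simp

lemma total_nonneg: "total \<ge> 0" and total_le: "total \<le> \<delta> / 2"
  using r_nonneg r_small by (auto simp: total_def intro: sum_nonneg)

lemma majorant_nonneg: "majorant \<ge> 0"
  unfolding majorant_def using delta by (intro suminf_nonneg) (simp_all add: summable_real_powr_iff)

lemma l2_log_powr_le: "sqrt (\<Sum>n. (log_powr \<sigma> k n)\<^sup>2) \<le> fact k / \<delta> ^ k * sqrt majorant"
proof -
  have "sqrt (\<Sum>n. (log_powr \<sigma> k n)\<^sup>2) \<le> sqrt ((fact k / \<delta> ^ k)\<^sup>2 * majorant)"
    unfolding majorant_def using log_powr_l2_bound(2)[OF delta] by (rule real_sqrt_le_mono)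
  then show ?thesis
    using delta by (simp add: real_sqrt_mult)
qed

lemma suminf_log_moment_le':
  "(\<Sum>n. cmod (h2_coeff f n * of_real (log_powr \<sigma> k n))) \<le> norm f * (fact k / \<delta> ^ k * sqrt majorant)"
  using suminf_log_moment_le[OF sigma_gt] mult_left_mono[OF l2_log_powr_le norm_ge_zero]
  by (rule order_trans)

lemma norm_log_moment_le': "cmod (log_moment \<sigma> k f) \<le> norm f * (fact k / \<delta> ^ k * sqrt majorant)"
  using norm_log_moment_le[OF sigma_gt] mult_left_mono[OF l2_log_powr_le norm_ge_zero]
  by (rule order_trans)

section \<open>Mean-square bounds for the coefficients of the composite\<close>

lemma image_coeff_block_le:
  assumes "finite A"
  shows "(\<Sum>m\<in>{m\<in>A. size (prime_factorization m) = k}. (cmod (image_coeff f m))\<^sup>2)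
    \<le> (cmod (log_moment \<sigma> k f) / fact k)\<^sup>2 * (\<Sum>m\<in>A. (coeff_pow k m)\<^sup>2)"
proof -
  have "(\<Sum>m\<in>{m\<in>A. size (prime_factorization m) = k}. (cmod (image_coeff f m))\<^sup>2)
      = (\<Sum>m\<in>{m\<in>A. size (prime_factorization m) = k}.
           (cmod (log_moment \<sigma> k f) / fact k)\<^sup>2 * (coeff_pow k m)\<^sup>2)"
    by (intro sum.cong) (auto simp: image_coeff_def norm_mult norm_divide power_mult_distrib
        power_divide simp del: of_real_divide)
  also have "\<dots> \<le> (\<Sum>m\<in>A. (cmod (log_moment \<sigma> k f) / fact k)\<^sup>2 * (coeff_pow k m)\<^sup>2)"
    using assms by (intro sum_mono2) auto
  finally show ?thesis
    by (simp add: sum_distrib_left)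
qed

text \<open>The integers are grouped by their number k of prime factors. The factorials cancel, so
  block k is at most a constant times \<open>q ^ k\<close>. Blocks 0 and 1 keep their moments; the
  others form a geometric tail starting at \<open>q\<^sup>2\<close>, which has order R^4.\<close>

lemma sum_image_coeff_le:
  assumes "finite A"
  shows "(\<Sum>m\<in>A. (cmod (image_coeff f m))\<^sup>2)
    \<le> (cmod (log_moment \<sigma> 0 f))\<^sup>2 + (\<Sum>j\<in>J. (r j)\<^sup>2) * (cmod (log_moment \<sigma> 1 f))\<^sup>2
      + 2 * majorant / \<delta> ^ 4 * total ^ 4 * (norm f)\<^sup>2"
proof -
  define B where "B k = (cmod (log_moment \<sigma> k f) / fact k)\<^sup>2 * (\<Sum>m\<in>A. (coeff_pow k m)\<^sup>2)" for k
  define q where "q = (total / \<delta>)\<^sup>2"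
  have "total / \<delta> \<le> 1/2" "total / \<delta> \<ge> 0"
    using delta total_le total_nonneg by (auto simp: field_simps)
  then have q: "0 \<le> q" "q \<le> 1/4"
    using power_mono[of "total / \<delta>" "1/2" 2] by (auto simp: q_def power2_eq_square)
  obtain N where N: "\<And>m. m \<in> A \<Longrightarrow> size (prime_factorization m) < N"
    using finite_nat_set_iff_bounded[of "(\<lambda>m. size (prime_factorization m)) ` A"] assms by auto
  have pow_le: "(\<Sum>m\<in>A. (coeff_pow k m)\<^sup>2) \<le> (total ^ k)\<^sup>2" for k
    using sum_power2_le_power2_sum[OF assms, of "coeff_pow k"] coeff_pow_nonneg
      power_mono[OF sum_coeff_pow_le[OF assms, of k], of 2]
    by (force simp: total_def intro: sum_nonneg coeff_pow_nonneg)
  have B_le: "B k \<le> (norm f)\<^sup>2 * majorant * q ^ k" for k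
  proof -
    have "cmod (log_moment \<sigma> k f) / fact k \<le> norm f * sqrt majorant / \<delta> ^ k"
      using norm_log_moment_le'[of k f] by (simp add: field_simps)
    then have "(cmod (log_moment \<sigma> k f) / fact k)\<^sup>2 \<le> (norm f * sqrt majorant / \<delta> ^ k)\<^sup>2"
      by (rule power_mono) simp
    then have "B k \<le> (norm f * sqrt majorant / \<delta> ^ k)\<^sup>2 * (total ^ k)\<^sup>2"
      unfolding B_def by (intro mult_mono pow_le) (auto intro: sum_nonneg)
    also have "\<dots> = (norm f)\<^sup>2 * (sqrt majorant)\<^sup>2 * ((total / \<delta>) ^ k)\<^sup>2"
      by (simp add: power_mult_distrib power_divide)
    also have "\<dots> = (norm f)\<^sup>2 * majorant * q ^ k"
      using majorant_nonneg by (simp add: q_def power_mult[symmetric] mult.commute)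
    finally show ?thesis .
  qed
  have B_nonneg: "B k \<ge> 0" for k
    by (auto simp: B_def intro!: sum_nonneg mult_nonneg_nonneg)
  have geo: "(\<Sum>k<N. q ^ k) \<le> 2"
  proof -
    have "(\<Sum>k<N. q ^ k) \<le> (\<Sum>k. q ^ k)"
      using q by (intro sum_le_suminf) auto
    also have "\<dots> = 1 / (1 - q)"
      using q by (subst suminf_geometric) auto
    also have "\<dots> \<le> 2"
      using q by (simp add: field_simps)
    finally show ?thesis .
  qed
  have "(\<Sum>m\<in>A. (cmod (image_coeff f m))\<^sup>2)
      = (\<Sum>k<N. \<Sum>m\<in>{m\<in>A. size (prime_factorization m) = k}. (cmod (image_coeff f m))\<^sup>2)"
    using assms N by (subst sum.group) auto
  also have "\<dots> \<le> (\<Sum>k<N. B k)"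
    unfolding B_def by (intro sum_mono image_coeff_block_le assms)
  \<comment> \<open>Two extra blocks allow k = 0 and k = 1 to be split off whatever \<open>N\<close>
    is.\<close>
  also have "\<dots> \<le> (\<Sum>k<Suc (Suc N). B k)"
    using B_nonneg by (intro sum_mono2) auto
  also have "\<dots> = B 0 + B 1 + (\<Sum>k<N. B (Suc (Suc k)))"
    by (simp only: sum.lessThan_Suc_shift) simp
  also have "B 0 \<le> (cmod (log_moment \<sigma> 0 f))\<^sup>2"
    using mult_left_mono[OF pow_le[of 0], of "(cmod (log_moment \<sigma> 0 f))\<^sup>2"] by (simp add: B_def)
  also have "B 1 \<le> (\<Sum>j\<in>J. (r j)\<^sup>2) * (cmod (log_moment \<sigma> 1 f))\<^sup>2"
    using mult_left_mono[OF sum_coeff_pow_1_power2_le[OF assms], of "(cmod (log_moment \<sigma> 1 f))\<^sup>2"]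
    by (simp add: B_def mult.commute)
  also have "(\<Sum>k<N. B (Suc (Suc k))) \<le> (\<Sum>k<N. (norm f)\<^sup>2 * majorant * q\<^sup>2 * q ^ k)"
    by (intro sum_mono order_trans[OF B_le]) (simp add: power2_eq_square mult_ac)
  also have "\<dots> = (norm f)\<^sup>2 * majorant * q\<^sup>2 * (\<Sum>k<N. q ^ k)"
    by (simp add: sum_distrib_left)
  also have "\<dots> \<le> (norm f)\<^sup>2 * majorant * q\<^sup>2 * 2"
    using geo majorant_nonneg by (intro mult_left_mono) auto
  also have "\<dots> = 2 * majorant / \<delta> ^ 4 * total ^ 4 * (norm f)\<^sup>2"
    by (simp add: q_def power_divide flip: power_mult)
  finally show ?thesis
    by simp
qed

lemma summable_image_coeff: "summable (\<lambda>m. (cmod (image_coeff f m))\<^sup>2)"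
  using sum_image_coeff_le[OF finite_lessThan] by (intro summableI_nonneg_bounded) auto

definition composite :: "h2 \<Rightarrow> h2" where
  "composite f = Abs_h2 (image_coeff f)"

lemma h2_coeff_composite: "h2_coeff (composite f) = image_coeff f"
  unfolding composite_def using summable_image_coeff
  by (intro Abs_h2_inverse) (simp add: image_coeff_def)

lemma norm_composite: "(norm (composite f))\<^sup>2 = (\<Sum>m. (cmod (image_coeff f m))\<^sup>2)"
  unfolding norm_h2 h2_coeff_composite by (simp add: suminf_nonneg summable_image_coeff)

lemma norm_composite_le:
  "(norm (composite f))\<^sup>2 \<le> (cmod (log_moment \<sigma> 0 f))\<^sup>2
     + (\<Sum>j\<in>J. (r j)\<^sup>2) * (cmod (log_moment \<sigma> 1 f))\<^sup>2
     + 2 * majorant / \<delta> ^ 4 * total ^ 4 * (norm f)\<^sup>2"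
  unfolding norm_composite by (intro suminf_le_const summable_image_coeff sum_image_coeff_le) simp

text \<open>Only the coefficients at 1 and at the primes \<open>p j\<close> are kept; they are
  exactly the zeroth moment and \<open>r j\<close> times the first.\<close>

lemma norm_composite_ge:
  "(cmod (log_moment \<sigma> 0 f))\<^sup>2 + (\<Sum>j\<in>J. (r j)\<^sup>2) * (cmod (log_moment \<sigma> 1 f))\<^sup>2
     \<le> (norm (composite f))\<^sup>2"
proof -
  have at_1: "image_coeff f 1 = log_moment \<sigma> 0 f"
    by (simp add: image_coeff_def)
  have at_p: "image_coeff f (p j) = of_real (r j) * log_moment \<sigma> 1 f" if "j \<in> J" for j
    using coeff_pow_1_eq[OF that] prime_p[OF that]
    by (simp add: image_coeff_def prime_factorization_prime)
  have "1 \<notin> p ` J"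
    using prime_p not_prime_1 by (metis imageE)
  then have "(\<Sum>m\<in>insert 1 (p ` J). (cmod (image_coeff f m))\<^sup>2)
      = (cmod (log_moment \<sigma> 0 f))\<^sup>2 + (\<Sum>j\<in>J. (cmod (image_coeff f (p j)))\<^sup>2)"
    using finite_J at_1 by (simp add: sum.reindex[OF inj_p])
  also have "(\<Sum>j\<in>J. (cmod (image_coeff f (p j)))\<^sup>2) = (\<Sum>j\<in>J. (r j)\<^sup>2) * (cmod (log_moment \<sigma> 1 f))\<^sup>2"
    by (simp add: at_p norm_mult power_mult_distrib sum_distrib_right cong: sum.cong)
  finally show ?thesis
    using sum_le_suminf[OF summable_image_coeff, of "insert 1 (p ` J)" f] finite_J
    by (simp add: norm_composite)
qed

section \<open>Identification of the composed function with its Dirichlet series\<close>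

lemma norm_powr_le_1: "Re s > 0 \<Longrightarrow> cmod (of_nat m powr (- s)) \<le> 1"
  using powr_mono[of "- Re s" 0 "real m"]
  by (cases "m = 0") (simp_all add: norm_powr_real_powr del: powr_minus)

lemma norm_symb_le:
  assumes "Re s > 0"
  shows "cmod (\<Sum>j\<in>J. of_real (r j) * of_nat (p j) powr (- s)) \<le> total"
  unfolding total_def
proof (rule order_trans[OF norm_sum sum_mono])
  fix j assume "j \<in> J"
  then show "cmod (of_real (r j) * of_nat (p j) powr (- s)) \<le> r j"
    using mult_left_mono[OF norm_powr_le_1[OF assms, of "p j"] r_nonneg, of j] r_nonneg[of j]
    by (simp add: norm_mult)
qed

text \<open>For n > 0 this is the exponential series of n^(-X) = exp(-X log n); for n = 0 both sides
  vanish.\<close>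

lemma powr_exp_series:
  "(\<lambda>k. of_real (log_powr \<sigma> k n) * (X ^ k / fact k))
    sums (of_nat n powr (- (complex_of_real \<sigma> + X)))"
proof (cases "n = 0")
  case False
  have "(\<lambda>k. (- of_real (ln (real n)) * X) ^ k /\<^sub>R fact k) sums exp (- of_real (ln (real n)) * X)"
    by (rule exp_converges)
  then have "(\<lambda>k. of_real (real n powr - \<sigma>) * ((- of_real (ln (real n)) * X) ^ k /\<^sub>R fact k))
      sums (of_real (real n powr - \<sigma>) * exp (- of_real (ln (real n)) * X))"
    by (rule sums_mult)
  also have "(\<lambda>k. of_real (real n powr - \<sigma>) * ((- of_real (ln (real n)) * X) ^ k /\<^sub>R fact k))
      = (\<lambda>k. of_real (log_powr \<sigma> k n) * (X ^ k / fact k))"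
    unfolding power_mult_distrib
    by (simp add: log_powr_def scaleR_conv_of_real divide_inverse mult_ac)
  also have "of_real (real n powr - \<sigma>) * exp (- of_real (ln (real n)) * X)
      = of_nat n powr (- (complex_of_real \<sigma> + X))"
    using False by (simp add: powr_def Ln_of_nat exp_of_real[symmetric] algebra_simps flip: exp_add)
  finally show ?thesis .
qed simp

lemma summable_moment_bound: "summable (\<lambda>k. norm f * sqrt majorant * (total / \<delta>) ^ k)"
  using delta total_le total_nonneg by (intro summable_mult summable_geometric) (simp add: field_simps)

text \<open>The factorial growth of the moment bound cancels against the Taylor denominator and
  leaves a geometric sequence.\<close>

lemma moment_bound_eq:
  "norm f * (fact k / \<delta> ^ k * sqrt majorant) * (total ^ k / fact k)
    = norm f * sqrt majorant * (total / \<delta>) ^ k"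
  by (simp add: power_divide)

text \<open>This is the Taylor expansion at \<sigma>: each n^(-\<sigma>-X) is expanded in powers of
  X. The geometric moment bound with |X| \<le> R justifies exchanging the sums over n and k.\<close>

lemma h2_eval_symb:
  assumes s: "Re s > 0" and X: "X = (\<Sum>j\<in>J. of_real (r j) * of_nat (p j) powr (- s))"
  shows "h2_eval f (symb s) = (\<Sum>k. log_moment \<sigma> k f * (X ^ k / fact k))"
proof -
  define F where "F k n = h2_coeff f n * of_real (log_powr \<sigma> k n) * (X ^ k / fact k)" for k n
  have nF: "cmod (F k n) = cmod (h2_coeff f n * of_real (log_powr \<sigma> k n)) * (cmod X ^ k / fact k)" for k n
    by (simp add: F_def norm_mult norm_divide norm_power)
  have sm: "summable (\<lambda>n. cmod (h2_coeff f n * of_real (log_powr \<sigma> k n)))" for k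
    by (rule summable_log_moment[OF sigma_gt])
  have "(\<Sum>k. \<Sum>n. F k n) = (\<Sum>n. \<Sum>k. F k n)"
  proof (rule suminf_swap_bounded[OF _ _ summable_moment_bound])
    show "summable (\<lambda>n. cmod (F k n))" for k
      unfolding nF by (intro summable_mult2 sm)
    have "cmod X ^ k / fact k \<le> total ^ k / fact k" for k
      using norm_symb_le[OF s] unfolding X by (intro divide_right_mono power_mono) auto
    then show "(\<Sum>n. cmod (F k n)) \<le> norm f * sqrt majorant * (total / \<delta>) ^ k" for k
      unfolding nF suminf_mult2[OF sm, symmetric] moment_bound_eq[symmetric]
      using delta majorant_nonneg by (intro mult_mono suminf_log_moment_le') auto
  qed
  moreover have "(\<Sum>n. F k n) = log_moment \<sigma> k f * (X ^ k / fact k)" for k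
    unfolding F_def log_moment_def by (rule suminf_mult2[OF summable_norm_cancel[OF sm], symmetric])
  moreover have "(\<Sum>k. F k n) = h2_coeff f n * of_nat n powr (- symb s)" for n
    unfolding F_def symb_def X[symmetric] mult.assoc
    by (intro sums_unique[symmetric] sums_mult powr_exp_series)
  ultimately show ?thesis
    by (simp add: h2_eval_def)
qed

text \<open>In the Taylor expansion every X^k is replaced by its Dirichlet series, and the sums over
  k and m are exchanged under the same geometric bound.\<close>

lemma h2_eval_composite:
  assumes s: "Re s > 0"
  shows "h2_eval (composite f) s = h2_eval f (symb s)"
proof -
  define w :: "nat \<Rightarrow> complex" where "w m = of_nat m powr (- s)" for m
  define X where "X = (\<Sum>j\<in>J. of_real (r j) * w (p j))"
  define F where "F k m = log_moment \<sigma> k f / fact k * (of_real (coeff_pow k m) * w m)" for k m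
  have "w 1 = 1" and "w (m * n) = w m * w n" for m n
    by (simp_all add: w_def powr_times_real)
  then have hs: "((\<lambda>m. of_real (coeff_pow k m) * w m) has_sum X ^ k) UNIV" for k
    unfolding X_def by (rule has_sum_coeff_pow)
  have "((\<lambda>m. coeff_pow k m) has_sum total ^ k) UNIV" for k
    using has_sum_coeff_pow[of "\<lambda>_. 1 :: real" k] by (simp add: total_def)
  then have weight: "(\<lambda>m. cmod (log_moment \<sigma> k f) / fact k * coeff_pow k m)
      sums (cmod (log_moment \<sigma> k f) / fact k * total ^ k)" for k
    by (intro sums_mult has_sum_imp_sums)
  have F_le: "cmod (F k m) \<le> cmod (log_moment \<sigma> k f) / fact k * coeff_pow k m" for k m
    using mult_left_mono[OF norm_powr_le_1[OF s, of m] coeff_pow_nonneg[of k m]] coeff_pow_nonneg[of k m]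
    by (auto simp: F_def w_def norm_mult norm_divide intro!: mult_left_mono divide_right_mono)
  have smF: "summable (\<lambda>m. cmod (F k m))" for k
    by (rule summable_comparison_test'[OF sums_summable[OF weight], of 0]) (use F_le in auto)
  have "(\<Sum>k. \<Sum>m. F k m) = (\<Sum>m. \<Sum>k. F k m)"
  proof (rule suminf_swap_bounded[OF smF _ summable_moment_bound])
    fix k
    have "(\<Sum>m. cmod (F k m)) \<le> cmod (log_moment \<sigma> k f) / fact k * total ^ k"
      using suminf_le[OF F_le smF sums_summable[OF weight]] weight by (simp add: sums_iff)
    also have "\<dots> = cmod (log_moment \<sigma> k f) * (total ^ k / fact k)"
      by simp
    also have "\<dots> \<le> norm f * sqrt majorant * (total / \<delta>) ^ k"
      unfolding moment_bound_eq[symmetric] using total_nonneg by (intro mult_right_mono norm_log_moment_le') auto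
    finally show "(\<Sum>m. cmod (F k m)) \<le> norm f * sqrt majorant * (total / \<delta>) ^ k" .
  qed
  moreover have "(\<Sum>k. F k m) = image_coeff f m * w m" for m
  proof -
    \<comment> \<open>By disjointness of the supports a single k survives for each m.\<close>
    have "(\<Sum>k. F k m) = (\<Sum>k\<in>{size (prime_factorization m)}. F k m)"
      using coeff_pow_neq_0 by (intro suminf_finite) (auto simp: F_def)
    then show ?thesis
      by (simp add: F_def image_coeff_def Let_def)
  qed
  moreover have "(\<Sum>m. F k m) = log_moment \<sigma> k f * (X ^ k / fact k)" for k
    using sums_mult[OF has_sum_imp_sums[OF hs], of "log_moment \<sigma> k f / fact k"]
    by (simp add: F_def sums_iff)
  ultimately show ?thesis
    using h2_eval_symb[OF s X_def[unfolded w_def]] by (simp add: h2_eval_def h2_coeff_composite w_def)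
qed

text \<open>Uniqueness of Dirichlet series resolves the definite description in
  \<open>comp_op\<close>.\<close>

lemma comp_op_symb: "comp_op symb f = composite f"
  unfolding comp_op_def
proof (rule the_equality)
  show "\<forall>s. Re s > 1/2 \<longrightarrow> h2_eval (composite f) s = h2_eval f (symb s)"
    by (simp add: h2_eval_composite)
  show "g = composite f" if "\<forall>s. Re s > 1/2 \<longrightarrow> h2_eval g s = h2_eval f (symb s)" for g
    using that by (intro h2_eval_inject) (simp add: h2_eval_composite)
qed

section \<open>Linearity, boundedness and the operator norm\<close>

lemma log_moment_add: "log_moment \<sigma> k (f + g) = log_moment \<sigma> k f + log_moment \<sigma> k g"
  unfolding log_moment_def plus_h2.rep_eq distrib_right
  by (intro suminf_add[symmetric] summable_norm_cancel[OF summable_log_moment[OF sigma_gt]])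

lemma log_moment_scaleR: "log_moment \<sigma> k (c *\<^sub>R f) = c *\<^sub>R log_moment \<sigma> k f"
  unfolding log_moment_def scaleR_h2.rep_eq mult_scaleR_left
  by (intro suminf_scaleR_right[symmetric] summable_norm_cancel[OF summable_log_moment[OF sigma_gt]])

lemma norm_composite_le_norm:
  assumes Z: "Z = (\<Sum>n. (log_powr \<sigma> 0 n)\<^sup>2)" and P: "P = - (\<Sum>n. log_powr \<sigma> 0 n * log_powr \<sigma> 1 n)"
    and Q: "Q = (\<Sum>n. (log_powr \<sigma> 1 n)\<^sup>2)" and S: "S = (\<Sum>j\<in>J. (r j)\<^sup>2)" and SQ: "2 * S * Q \<le> Z"
  shows "(norm (composite f))\<^sup>2
    \<le> (Z + S * P\<^sup>2 / Z + 2 * S\<^sup>2 * P\<^sup>2 * Q / Z\<^sup>2 + 2 * majorant / \<delta> ^ 4 * total ^ 4) * (norm f)\<^sup>2"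
proof -
  have "S \<ge> 0"
    by (auto simp: S intro: sum_nonneg)
  from log_moment_pair_le[OF sigma_gt this Z P Q SQ, of f] norm_composite_le[of f]
  show ?thesis
    by (simp only: S distrib_right)
qed

text \<open>Cauchy-Schwarz applied to the two moments separately gives a cruder constant than
  \<open>norm_composite_le_norm\<close>, which suffices for boundedness.\<close>

lemma bounded_linear_composite: "bounded_linear composite"
proof (rule bounded_linear_intro)
  fix f g :: h2 and c :: real
  show "composite (f + g) = composite f + composite g"
    by (simp add: h2_coeff_inject[symmetric] fun_eq_iff h2_coeff_composite plus_h2.rep_eq
        image_coeff_def log_moment_add Let_def distrib_left)
  show "composite (c *\<^sub>R f) = c *\<^sub>R composite f"
    by (simp add: h2_coeff_inject[symmetric] fun_eq_iff h2_coeff_composite scaleR_h2.rep_eq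
        image_coeff_def log_moment_scaleR Let_def)
  define l where "l k = (\<Sum>n. (log_powr \<sigma> k n)\<^sup>2)" for k
  define S where "S = (\<Sum>j\<in>J. (r j)\<^sup>2)"
  have l: "l k \<ge> 0" "(cmod (log_moment \<sigma> k f))\<^sup>2 \<le> (norm f)\<^sup>2 * l k" for k
  proof -
    show *: "l k \<ge> 0"
      unfolding l_def by (intro suminf_nonneg summable_log_powr_power2 sigma_gt) auto
    show "(cmod (log_moment \<sigma> k f))\<^sup>2 \<le> (norm f)\<^sup>2 * l k"
      using power_mono[OF norm_log_moment_le[OF sigma_gt, of k f], of 2] *
      by (simp add: power_mult_distrib l_def)
  qed
  have S: "S \<ge> 0"
    by (auto simp: S_def intro: sum_nonneg)
  let ?M = "l 0 + S * l 1 + 2 * majorant / \<delta> ^ 4 * total ^ 4"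
  have "(norm (composite f))\<^sup>2
      \<le> (norm f)\<^sup>2 * l 0 + S * ((norm f)\<^sup>2 * l 1) + 2 * majorant / \<delta> ^ 4 * total ^ 4 * (norm f)\<^sup>2"
    unfolding S_def
    by (rule order_trans[OF norm_composite_le])
       (intro add_mono mult_left_mono l order_refl sum_nonneg zero_le_power2)
  also have "\<dots> = (norm f * sqrt ?M)\<^sup>2"
    using l S majorant_nonneg total_nonneg delta by (simp add: power_mult_distrib algebra_simps)
  finally show "norm (composite f) \<le> norm f * sqrt ?M"
    by (rule power2_le_imp_le) (use l S majorant_nonneg total_nonneg delta in auto)
qed

lemma bounded_comp_op_symb: "bounded_comp_op symb"
  unfolding bounded_comp_op_def
  using bounded_linear_composite h2_eval_composite comp_op_symb[abs_def]
  by (auto intro!: exI[of _ "composite _"])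

text \<open>The lower bound comes from one test function, the upper bound from
  \<open>norm_composite_le_norm\<close>.\<close>

lemma onorm_comp_op_symb:
  assumes Z: "Z = (\<Sum>n. (log_powr \<sigma> 0 n)\<^sup>2)" and P: "P = - (\<Sum>n. log_powr \<sigma> 0 n * log_powr \<sigma> 1 n)"
    and Q: "Q = (\<Sum>n. (log_powr \<sigma> 1 n)\<^sup>2)" and S: "S = (\<Sum>j\<in>J. (r j)\<^sup>2)" and SQ: "2 * S * Q \<le> Z"
  shows "Z + S * P\<^sup>2 / Z \<le> (onorm (comp_op symb))\<^sup>2"
    and "(onorm (comp_op symb))\<^sup>2
      \<le> Z + S * P\<^sup>2 / Z + 2 * S\<^sup>2 * P\<^sup>2 * Q / Z\<^sup>2 + 2 * majorant / \<delta> ^ 4 * total ^ 4"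
      (is "_ \<le> ?M")
proof -
  have sm: "summable (\<lambda>n. (log_powr \<sigma> k n)\<^sup>2)" for k
    by (rule summable_log_powr_power2[OF sigma_gt])
  have "Z > 0"
    unfolding Z using sm by (rule suminf_pos2[of _ 1]) (auto simp: log_powr_def)
  have "Q \<ge> 0"
    unfolding Q using sm by (rule suminf_nonneg) auto
  have "S \<ge> 0"
    by (auto simp: S intro: sum_nonneg)
  have M: "?M \<ge> 0"
    using \<open>Z > 0\<close> \<open>Q \<ge> 0\<close> \<open>S \<ge> 0\<close> majorant_nonneg total_nonneg delta by (intro add_nonneg_nonneg) auto
  have onorm_eq: "onorm (comp_op symb) = onorm composite"
    by (simp add: comp_op_symb[abs_def])
  have onorm_nonneg: "onorm composite \<ge> 0"
    by (rule onorm_pos_le[OF bounded_linear_composite])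
  have "norm (composite f) \<le> sqrt ?M * norm f" for f
  proof (rule power2_le_imp_le)
    show "(norm (composite f))\<^sup>2 \<le> (sqrt ?M * norm f)\<^sup>2"
      using norm_composite_le_norm[OF Z P Q S SQ, of f] M by (simp add: power_mult_distrib)
  qed (use M in auto)
  then have "onorm composite \<le> sqrt ?M"
    using M by (intro onorm_bound) auto
  then show "(onorm (comp_op symb))\<^sup>2 \<le> ?M"
    using power_mono[of "onorm composite" "sqrt ?M" 2] onorm_nonneg M by (simp add: onorm_eq)
  \<comment> \<open>The test function is the reproducing kernel at \<sigma>: its squared norm and
    its zeroth moment are both \<open>Z\<close>, and its first moment is \<open>- P\<close>.\<close>
  define f where "f = Abs_h2 (\<lambda>n. of_real (log_powr \<sigma> 0 n))"
  have f: "h2_coeff f = (\<lambda>n. of_real (log_powr \<sigma> 0 n))"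
    unfolding f_def using sm by (intro Abs_h2_inverse) simp
  have norm_f: "(norm f)\<^sup>2 = Z"
    unfolding norm_h2 f Z using sm by (simp add: suminf_nonneg)
  have "log_moment \<sigma> k f = of_real (\<Sum>n. log_powr \<sigma> 0 n * log_powr \<sigma> k n)" for k
    unfolding log_moment_def f of_real_mult[symmetric]
    by (intro suminf_of_real[symmetric] summable_rabs_cancel[OF summable_log_powr_mult[OF sigma_gt]])
  then have "log_moment \<sigma> 0 f = of_real Z" "log_moment \<sigma> 1 f = of_real (- P)"
    by (simp_all add: Z P power2_eq_square)
  then have "Z\<^sup>2 + S * P\<^sup>2 \<le> (norm (composite f))\<^sup>2"
    using norm_composite_ge[of f] by (simp add: S)
  also have "\<dots> \<le> (onorm composite * norm f)\<^sup>2"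
    by (intro power_mono onorm[OF bounded_linear_composite]) simp
  also have "\<dots> = (onorm composite)\<^sup>2 * Z"
    by (simp add: power_mult_distrib norm_f)
  finally show "Z + S * P\<^sup>2 / Z \<le> (onorm (comp_op symb))\<^sup>2"
    using \<open>Z > 0\<close> by (simp add: onorm_eq field_simps power2_eq_square)
qed

end

section \<open>Choice of constants and the final estimate\<close>

theorem theorem4p4:
  fixes d :: nat and p :: "nat \<Rightarrow> nat" and \<sigma> :: real
  assumes "d \<ge> 1"
    and "\<And>j. j \<in> {1..d} \<Longrightarrow> prime (p j)"
    and "inj_on p {1..d}"
    and "\<sigma> > 1/2"
  shows "\<exists>K>0. \<exists>R0>0. \<forall>r :: nat \<Rightarrow> real.
    (\<forall>j\<in>{1..d}. r j \<ge> 0) \<longrightarrow> (\<Sum>j=1..d. r j) < \<sigma> - 1/2 \<longrightarrow> (\<Sum>j=1..d. r j) \<le> R0 \<longrightarrow>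
    (let \<phi> = (\<lambda>s. of_real \<sigma> + (\<Sum>j=1..d. of_real (r j) * of_nat (p j) powr (- s)))
     in bounded_comp_op \<phi> \<and>
        cmod (of_real ((onorm (comp_op \<phi>))\<^sup>2)
              - (zeta (of_real (2 * \<sigma>))
                 + (deriv zeta (of_real (2 * \<sigma>)))\<^sup>2 / zeta (of_real (2 * \<sigma>))
                   * of_real (\<Sum>j=1..d. (r j)\<^sup>2)))
          \<le> K * (\<Sum>j=1..d. r j) ^ 4)"
proof -
  define Z where "Z = (\<Sum>n. (log_powr \<sigma> 0 n)\<^sup>2)"
  define P where "P = - (\<Sum>n. log_powr \<sigma> 0 n * log_powr \<sigma> 1 n)"
  define Q where "Q = (\<Sum>n. (log_powr \<sigma> 1 n)\<^sup>2)"
  define \<delta> where "\<delta> = (\<sigma> - 1/2) / 2"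
  define D where "D = (\<Sum>n. real n powr (2 * (\<delta> - \<sigma>)))"
  \<comment> \<open>The two summands are the constants of the two R^4 errors, after
    \<open>S\<^sup>2\<close> is bounded by R^4; the 1 ensures positivity.\<close>
  define K where "K = 2 * P\<^sup>2 * Q / Z\<^sup>2 + 2 * D / \<delta> ^ 4 + 1"
  \<comment> \<open>The first bound gives R \<le> \<delta>/2. The second gives \<open>S\<close>
    \<le> R^2 \<le> \<open>Z / (2 * (Q + 1))\<close>, hence \<open>2 * S * Q \<le> Z\<close>; the
    shift by 1 keeps the denominator positive.\<close>
  define R0 where "R0 = min (\<delta> / 2) (sqrt (Z / (2 * (Q + 1))))"
  have sm: "summable (\<lambda>n. (log_powr \<sigma> k n)\<^sup>2)" for k
    by (rule summable_log_powr_power2[OF assms(4)])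
  have "Z > 0"
    unfolding Z_def using sm by (rule suminf_pos2[of _ 1]) (auto simp: log_powr_def)
  have "Q \<ge> 0"
    unfolding Q_def using sm by (rule suminf_nonneg) auto
  have \<delta>: "\<delta> > 0" "\<sigma> - \<delta> > 1/2"
    using assms(4) by (auto simp: \<delta>_def field_simps)
  have "D \<ge> 0"
    unfolding D_def using \<delta> by (intro suminf_nonneg) (simp_all add: summable_real_powr_iff)
  have "K > 0"
    unfolding K_def using \<open>Q \<ge> 0\<close> \<open>D \<ge> 0\<close> by (intro add_nonneg_pos) auto
  have "R0 > 0"
    using \<delta> \<open>Z > 0\<close> \<open>Q \<ge> 0\<close> by (simp add: R0_def)
  show ?thesis
  proof (rule exI[of _ K], rule conjI[OF \<open>K > 0\<close>], rule exI[of _ R0], rule conjI[OF \<open>R0 > 0\<close>],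
      intro allI impI)
    fix r :: "nat \<Rightarrow> real"
    assume r: "\<forall>j\<in>{1..d}. r j \<ge> 0" and R_le: "(\<Sum>j=1..d. r j) \<le> R0"
    interpret small_prime_symbol "{1..d}" p r \<sigma> \<delta>
      by standard (use assms r R_le \<delta> in \<open>auto simp: R0_def\<close>)
    define S where "S = (\<Sum>j=1..d. (r j)\<^sup>2)"
    have S: "0 \<le> S" "S \<le> total\<^sup>2"
      using sum_power2_le_power2_sum[of "{1..d}" r] r unfolding S_def total_def by (auto intro: sum_nonneg)
    have "total\<^sup>2 \<le> (sqrt (Z / (2 * (Q + 1))))\<^sup>2"
      using R_le total_nonneg unfolding R0_def total_def by (intro power_mono) auto
    also have "\<dots> = Z / (2 * (Q + 1))"
      using \<open>Z > 0\<close> \<open>Q \<ge> 0\<close> by simp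
    finally have "S \<le> Z / (2 * (Q + 1))"
      using S by simp
    then have "2 * S * Q + 2 * S \<le> Z"
      using \<open>Q \<ge> 0\<close> by (simp add: field_simps)
    then have SQ: "2 * S * Q \<le> Z"
      using S by simp
    note bounds = onorm_comp_op_symb[OF Z_def P_def Q_def S_def SQ]
    have "S\<^sup>2 \<le> total ^ 4"
      using power_mono[OF S(2,1), of 2] by (simp flip: power_mult)
    then have "S\<^sup>2 * (2 * P\<^sup>2 * Q / Z\<^sup>2) \<le> total ^ 4 * (2 * P\<^sup>2 * Q / Z\<^sup>2)"
      using \<open>Q \<ge> 0\<close> by (intro mult_right_mono) auto
    then have "2 * S\<^sup>2 * P\<^sup>2 * Q / Z\<^sup>2 + 2 * D / \<delta> ^ 4 * total ^ 4 \<le> K * total ^ 4"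
      unfolding K_def distrib_right by (simp add: mult_ac add_increasing2)
    \<comment> \<open>The lower bound carries no error term, so the deviation is nonnegative and
      only the upper bound has to be estimated.\<close>
    then have "\<bar>(onorm (comp_op symb))\<^sup>2 - (Z + P\<^sup>2 / Z * S)\<bar> \<le> K * total ^ 4"
      using bounds unfolding majorant_def D_def[symmetric] by (simp add: mult_ac)
    moreover have "zeta (of_real (2 * \<sigma>)) = of_real Z"
      unfolding Z_def by (rule zeta_of_real[OF assms(4)])
    \<comment> \<open>The sign of \<open>P\<close> disappears when the derivative is
      squared.\<close>
    moreover have "deriv zeta (of_real (2 * \<sigma>)) = of_real (- P)"
      unfolding P_def by (simp only: deriv_zeta_of_real[OF assms(4)] minus_minus)
    moreover have "symb = (\<lambda>s. of_real \<sigma> + (\<Sum>j=1..d. of_real (r j) * of_nat (p j) powr (- s)))"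
      by (intro ext) (rule symb_def)
    moreover have "cmod (of_real ((onorm (comp_op symb))\<^sup>2)
        - (of_real Z + (of_real (- P))\<^sup>2 / of_real Z * of_real S))
        = \<bar>(onorm (comp_op symb))\<^sup>2 - (Z + P\<^sup>2 / Z * S)\<bar>"
      unfolding norm_of_real[symmetric, where 'a = complex] by simp
    ultimately show "let \<phi> = (\<lambda>s. of_real \<sigma> + (\<Sum>j=1..d. of_real (r j) * of_nat (p j) powr (- s)))
      in bounded_comp_op \<phi> \<and>
        cmod (of_real ((onorm (comp_op \<phi>))\<^sup>2)
              - (zeta (of_real (2 * \<sigma>))
                 + (deriv zeta (of_real (2 * \<sigma>)))\<^sup>2 / zeta (of_real (2 * \<sigma>))
                   * of_real (\<Sum>j=1..d. (r j)\<^sup>2)))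
          \<le> K * (\<Sum>j=1..d. r j) ^ 4"
      using bounded_comp_op_symb by (simp only: Let_def S_def total_def simp_thms)
  qed
qed

end
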